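(* Let $n\ge1$ and $\alpha^1,\dots,\alpha^n\in\mathrm{ord}$. It is impossible that $\alpha^i<\alpha^1,\dots,\alpha^n$ holds for every $i\in\{1,\dots,n\}$.
   Context: Work constructively. Let $\mathfrak F$ be a set of index sets containing $\mathbb N$ and each $\mathbb N_k=\{n\in\mathbb N:n<k\}$ ($k\ge0$), closed (up to isomorphism) under finitely enumerated subsets, sets of finitely enumerated subsets, and disjoint unions indexed by elements of $\mathfrak F$. A finitely enumerated subset of $A$ is one given by a map $\mathbb N_k\to A$; write $F\subseteq_f I$. The set $\mathrm{ord}$ is inductively generated by $\underline 0$ and, for every family $(\alpha_i)_{i\in I}$ with $I\in\mathfrak F$, $\alpha_i\in\mathrm{ord}$, an element $\mathrm S(\alpha_i)_{i\in I}$; for such $\alpha$, $I_\alpha=I$ and $\alpha_i$ are its definitional subordinals; $I_{\underline 0}=\emptyset$. For a finite list $F$ in $I_\alpha$, $\alpha_F$ is the list of the $\alpha_i$, $i\in F$. Relations between an element and a nonempty finite list, by simultaneous induction: $\alpha\le\beta^1,\dots,\beta^m$ means $\alpha_i<\beta^1,\dots,\beta^m$ for all $i\in I_\alpha$; $\alpha<\beta^1,\dots,\beta^m$ means there exist $F_1\subseteq_f I_{\beta^1},\dots,F_m\subseteq_f I_{\beta^m}$, not all empty, with $\alpha\le\beta^1_{F_1},\dots,\beta^m_{F_m}$ (concatenated list). *)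

theory Defs
  imports Main
begin

text \<open>Ordinal notations: an element is either the zero notation or S applied to a
  family indexed by a set I; the family is represented by its index set together
  with a function on the index type (values outside I are irrelevant).\<close>

datatype 'i ord = Zero | S "'i set" "'i \<Rightarrow> 'i ord"

fun idx :: "'i ord \<Rightarrow> 'i set" where
  "idx Zero = {}"
| "idx (S I f) = I"

fun sub :: "'i ord \<Rightarrow> 'i \<Rightarrow> 'i ord" where
  "sub Zero i = Zero"
| "sub (S I f) i = f i"

inductive in_ord :: "'i set set \<Rightarrow> 'i ord \<Rightarrow> bool" for F where
  "in_ord F Zero"
| "I \<in> F \<Longrightarrow> (\<forall>i. i \<in> I \<longrightarrow> in_ord F (f i)) \<Longrightarrow> in_ord F (S I f)"

text \<open>alpha_F for a finitely enumerated subset F (a list of indices).\<close>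
definition subs :: "'i ord \<Rightarrow> 'i list \<Rightarrow> 'i ord list" where
  "subs \<beta> Fs = map (sub \<beta>) Fs"

inductive ord_le :: "'i ord \<Rightarrow> 'i ord list \<Rightarrow> bool"
  and ord_lt :: "'i ord \<Rightarrow> 'i ord list \<Rightarrow> bool" where
  le_intro: "\<beta>s \<noteq> [] \<Longrightarrow> (\<forall>i. i \<in> idx \<alpha> \<longrightarrow> ord_lt (sub \<alpha> i) \<beta>s) \<Longrightarrow> ord_le \<alpha> \<beta>s"
| lt_intro: "length Fs = length \<beta>s \<Longrightarrow>
    (\<forall>j < length \<beta>s. set (Fs ! j) \<subseteq> idx (\<beta>s ! j)) \<Longrightarrow>
    (\<exists>j < length \<beta>s. Fs ! j \<noteq> []) \<Longrightarrow>
    ord_le \<alpha> (concat (map (\<lambda>j. subs (\<beta>s ! j) (Fs ! j)) [0..<length \<beta>s])) \<Longrightarrow>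
    ord_lt \<alpha> \<beta>s"

end

theory Submission
  imports Defs "HOL-Library.Multiset"
begin

text \<open>Suppose every \<open>\<alpha>\<^sup>i\<close> satisfies \<open>\<alpha>\<^sup>i < \<alpha>\<^sup>1,\<dots>,\<alpha>\<^sup>n\<close>. Each witness list consists of
  definitional subordinals of the \<open>\<alpha>\<^sup>j\<close>, and since the relations only depend on the
  set of elements of the right-hand list, concatenating the witnesses gives a nonempty
  list \<open>\<delta>\<^sup>1,\<dots>,\<delta>\<^sup>k\<close> with the same property. Replacing the multiset of the \<open>\<alpha>\<^sup>i\<close> by that
  of the \<open>\<delta>\<^sup>j\<close> is a step down in the multiset extension of the well-founded
  subordinal relation, so this cannot go on forever.\<close>

definition sub_rel :: "('i ord \<times> 'i ord) set" where
  "sub_rel = {(sub \<alpha> x, \<alpha>) | \<alpha> x. x \<in> idx \<alpha>}"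

definition def_subords :: "'i ord list \<Rightarrow> 'i ord set" where
  "def_subords \<beta>s = {sub \<beta> x | \<beta> x. \<beta> \<in> set \<beta>s \<and> x \<in> idx \<beta>}"

definition concat_subs :: "'i ord list \<Rightarrow> 'i list list \<Rightarrow> 'i ord list" where
  "concat_subs \<beta>s Fs = concat (map (\<lambda>j. subs (\<beta>s ! j) (Fs ! j)) [0..<length \<beta>s])"

lemma wf_sub_rel: "wf sub_rel"
proof (rule wfUNIVI)
  fix P :: "'i ord \<Rightarrow> bool" and \<alpha> :: "'i ord"
  assume step: "\<forall>\<alpha>. (\<forall>\<beta>. (\<beta>, \<alpha>) \<in> sub_rel \<longrightarrow> P \<beta>) \<longrightarrow> P \<alpha>"
  show "P \<alpha>"
  proof (induction \<alpha>)
    case Zero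
    then show ?case using step by (auto simp: sub_rel_def)
  next
    case (S I f)
    then show ?case using step[rule_format, of "S I f"] by (auto simp: sub_rel_def)
  qed
qed

lemma set_concat_subs:
  assumes "\<forall>j < length \<beta>s. set (Fs ! j) \<subseteq> idx (\<beta>s ! j)"
  shows "set (concat_subs \<beta>s Fs) \<subseteq> def_subords \<beta>s"
  using assms by (fastforce simp: concat_subs_def subs_def def_subords_def)

lemma concat_subs_nonempty:
  "concat_subs \<beta>s Fs \<noteq> [] \<Longrightarrow> \<exists>j < length \<beta>s. Fs ! j \<noteq> []"
  by (auto simp: concat_subs_def subs_def)

lemma concat_subs_cover:
  assumes "set D \<subseteq> def_subords \<beta>s"
  obtains Fs where "length Fs = length \<beta>s"
    and "\<forall>j < length \<beta>s. set (Fs ! j) \<subseteq> idx (\<beta>s ! j)"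
    and "set D \<subseteq> set (concat_subs \<beta>s Fs)"
proof -
  have "\<forall>\<delta> \<in> set D. \<exists>w. fst w < length \<beta>s \<and> snd w \<in> idx (\<beta>s ! fst w) \<and> \<delta> = sub (\<beta>s ! fst w) (snd w)"
    using assms by (fastforce simp: def_subords_def in_set_conv_nth)
  then obtain w where w: "\<And>\<delta>. \<delta> \<in> set D \<Longrightarrow>
      fst (w \<delta>) < length \<beta>s \<and> snd (w \<delta>) \<in> idx (\<beta>s ! fst (w \<delta>)) \<and> \<delta> = sub (\<beta>s ! fst (w \<delta>)) (snd (w \<delta>))"
    by metis
  define Fs where "Fs = map (\<lambda>j. map (snd \<circ> w) (filter (\<lambda>\<delta>. fst (w \<delta>) = j) D)) [0..<length \<beta>s]"
  have "\<delta> \<in> set (concat_subs \<beta>s Fs)" if "\<delta> \<in> set D" for \<delta>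
    using w[OF that] that by (force simp: Fs_def concat_subs_def subs_def)
  then show thesis
    using w by (intro that[of Fs]) (auto simp: Fs_def)
qed

lemma ord_le_nonempty: "ord_le \<alpha> \<beta>s \<Longrightarrow> \<beta>s \<noteq> []"
  by (cases rule: ord_le.cases) auto

lemma ord_le_ord_lt_mono:
  shows "ord_le \<alpha> \<beta>s \<Longrightarrow> set \<beta>s \<subseteq> set \<beta>s' \<Longrightarrow> ord_le \<alpha> \<beta>s'"
    and "ord_lt \<alpha> \<beta>s \<Longrightarrow> set \<beta>s \<subseteq> set \<beta>s' \<Longrightarrow> ord_lt \<alpha> \<beta>s'"
proof (induction arbitrary: \<beta>s' and \<beta>s' rule: ord_le_ord_lt.inducts)
  case (le_intro \<beta>s \<alpha>)
  then show ?case by (intro ord_le_ord_lt.le_intro) auto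
next
  case (lt_intro Fs \<beta>s \<alpha>)
  have "set (concat_subs \<beta>s Fs) \<subseteq> def_subords \<beta>s'"
    using set_concat_subs[OF lt_intro.hyps(2)] lt_intro.prems unfolding def_subords_def by blast
  then obtain Fs' where Fs': "length Fs' = length \<beta>s'"
      "\<forall>j < length \<beta>s'. set (Fs' ! j) \<subseteq> idx (\<beta>s' ! j)"
      "set (concat_subs \<beta>s Fs) \<subseteq> set (concat_subs \<beta>s' Fs')"
    by (rule concat_subs_cover)
  have le: "ord_le \<alpha> (concat_subs \<beta>s' Fs')"
    using lt_intro.IH Fs'(3) by (simp add: concat_subs_def)
  then have "\<exists>j < length \<beta>s'. Fs' ! j \<noteq> []"
    by (intro concat_subs_nonempty ord_le_nonempty)
  with Fs'(1,2) le show ?case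
    by (intro ord_le_ord_lt.lt_intro) (simp_all add: concat_subs_def)
qed

lemma ord_lt_imp_ord_le_def_subords:
  "ord_lt \<alpha> \<beta>s \<Longrightarrow> \<exists>D. set D \<subseteq> def_subords \<beta>s \<and> ord_le \<alpha> D"
proof -
  assume "ord_lt \<alpha> \<beta>s"
  then obtain Fs where "\<forall>j < length \<beta>s. set (Fs ! j) \<subseteq> idx (\<beta>s ! j)"
      and "ord_le \<alpha> (concat_subs \<beta>s Fs)"
    by (cases rule: ord_lt.cases) (auto simp: concat_subs_def)
  then show ?thesis
    using set_concat_subs by blast
qed

lemma ex_not_ord_lt_list:
  "\<gamma>s \<noteq> [] \<Longrightarrow> \<exists>\<gamma> \<in> set \<gamma>s. \<not> ord_lt \<gamma> \<gamma>s"
proof (induction \<gamma>s rule: wf_induct_rule[OF wf_inv_image[OF wf_mult[OF wf_sub_rel], of mset]])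
  case (1 \<gamma>s)
  show ?case
  proof (rule ccontr)
    assume "\<not> ?case"
    then have "\<forall>\<gamma> \<in> set \<gamma>s. \<exists>D. set D \<subseteq> def_subords \<gamma>s \<and> ord_le \<gamma> D"
      using ord_lt_imp_ord_le_def_subords by blast
    then obtain W where W: "\<And>\<gamma>. \<gamma> \<in> set \<gamma>s \<Longrightarrow> set (W \<gamma>) \<subseteq> def_subords \<gamma>s \<and> ord_le \<gamma> (W \<gamma>)"
      by metis
    define D where "D = concat (map W \<gamma>s)"
    have D_sub: "set D \<subseteq> def_subords \<gamma>s"
      using W by (auto simp: D_def)
    have "D \<noteq> []"
      using "1.prems" W[OF hd_in_set] ord_le_nonempty by (force simp: D_def)
    moreover have "\<forall>\<delta> \<in> set D. ord_lt \<delta> D"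
    proof
      fix \<delta> assume "\<delta> \<in> set D"
      then obtain \<gamma> x where \<gamma>: "\<gamma> \<in> set \<gamma>s" "x \<in> idx \<gamma>" "\<delta> = sub \<gamma> x"
        using D_sub by (auto simp: def_subords_def)
      have "ord_lt \<delta> (W \<gamma>)"
        using W[OF \<gamma>(1)] \<gamma>(2,3) by (auto elim: ord_le.cases)
      moreover have "set (W \<gamma>) \<subseteq> set D"
        using \<gamma>(1) by (auto simp: D_def)
      ultimately show "ord_lt \<delta> D"
        by (rule ord_le_ord_lt_mono(2))
    qed
    moreover have "(mset D, mset \<gamma>s) \<in> mult sub_rel"
    proof -
      have "\<forall>\<delta> \<in> set D. \<exists>\<gamma> \<in> set \<gamma>s. (\<delta>, \<gamma>) \<in> sub_rel"
        using D_sub unfolding def_subords_def sub_rel_def by blast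
      then show ?thesis
        using one_step_implies_mult[of "mset \<gamma>s" "mset D" sub_rel "{#}"] "1.prems" by simp
    qed
    ultimately show False
      using "1.IH" by auto
  qed
qed

theorem lemma4p5:
  fixes F :: "'i set set" and \<alpha>s :: "'i ord list"
  assumes "length \<alpha>s \<ge> 1"
    and "\<forall>i < length \<alpha>s. in_ord F (\<alpha>s ! i)"
  shows "\<not> (\<forall>i < length \<alpha>s. ord_lt (\<alpha>s ! i) \<alpha>s)"
proof -
  have "\<alpha>s \<noteq> []"
    using assms(1) by auto
  then show ?thesis
    using ex_not_ord_lt_list[of \<alpha>s] by (auto simp: in_set_conv_nth)
qed

end
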